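(* Fix $a<b$, an integer $K\ge 1$, $\sigma>0$ and $x_0\in[a,b]$. The mixed regression model over $\mathcal{R}_{x_0}$ is identifiable: if $(p_X,f,\{\lambda_k\}_{k=1}^K,\{m_k\}_{k=1}^K)$ and $(q_X,g,\{\pi_k\}_{k=1}^K,\{\mu_k\}_{k=1}^K)$ both belong to $\mathcal{R}_{x_0}$ and $$p_X(x)\sum_{k=1}^K\lambda_k f(y-m_k(x))=q_X(x)\sum_{k=1}^K\pi_k g(y-\mu_k(x))\qquad\text{for all }(x,y)\in[a,b]\times\mathbb{R},$$ then $p_X=q_X$, $f=g$, and there is a permutation $\Pi$ of $\{1,\dots,K\}$ such that $\pi_k=\lambda_{\Pi(k)}$ and $\mu_k=m_{\Pi(k)}$ on $[a,b]$ for every $k$.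
   Context: $\phi_\sigma$ is the density of $\mathcal{N}(0,\sigma^2)$; for a probability measure $G$ on $\mathbb{R}$, $(\phi_\sigma\ast G)(y)=\int\phi_\sigma(y-\theta)\,dG(\theta)$. For $\Omega\subset\mathbb{R}$, $\mathcal{P}(\Omega)$ is the set of probability densities on $\Omega$ and $\mathcal{C}^0([a,b])$ the set of continuous real functions on $[a,b]$. $\mathcal{R}_{x_0}$ is the set of tuples $(p_X,f,\{\lambda_k\}_{k=1}^K,\{m_k\}_{k=1}^K)\in\mathcal{P}([a,b])\times\mathcal{P}(\mathbb{R})\times\mathbb{R}^K\times[\mathcal{C}^0([a,b])]^K$ with $\inf_{[a,b]}p_X>0$, $\int_{\mathbb{R}}y f(y)\,dy=0$, $\min_k\lambda_k>0$, $\sum_k\lambda_k=1$, and such that: (A1) $f=\phi_\sigma\ast G_0$ for some compactly supported probability measure $G_0$ on $\mathbb{R}$; (A2) $\min_{j\ne k}|\lambda_j-\lambda_k|>0$; (A3) $\min_{j\ne k}|m_j(x_0)-m_k(x_0)|>2\operatorname{diam}(\operatorname{supp}(G_0))$; (A4) the set $Z=\{x\in[a,b]:\exists\, j\ne k,\ m_j(x)=m_k(x)\}$ is countable. The number $\sigma$ is the same for all members of the class (it is fixed and known), as are $K$ and $x_0$. *)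

theory Defs
  imports "HOL-Probability.Probability"
begin

definition prob_densities :: "real set \<Rightarrow> (real \<Rightarrow> real) set" where
  "prob_densities \<Omega> = {p. (\<forall>x\<in>\<Omega>. 0 \<le> p x) \<and> set_integrable lebesgue \<Omega> p \<and>
     (LINT x:\<Omega>|lebesgue. p x) = 1}"

definition gauss_conv :: "real \<Rightarrow> real measure \<Rightarrow> real \<Rightarrow> real" where
  "gauss_conv \<sigma> G y = (LINT \<theta>|G. normal_density 0 \<sigma> (y - \<theta>))"

definition measure_support :: "'a::topological_space measure \<Rightarrow> 'a set" where
  "measure_support G = {x. \<forall>U. open U \<and> x \<in> U \<longrightarrow> emeasure G U > 0}"

(* Functions on the interval {a..b} are total functions of which only the restriction to
   {a..b} matters, and families indexed by {1..K} are functions on nat of which only the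
   values at 1, ..., K matter.
   The conditions "min_{j \<noteq> k} ... > c" are written as quantified inequalities, so that they
   hold vacuously for K = 1 (minimum over the empty set is +infinity). *)
definition mixed_regression_class ::
  "real \<Rightarrow> real \<Rightarrow> nat \<Rightarrow> real \<Rightarrow> real \<Rightarrow>
   ((real \<Rightarrow> real) \<times> (real \<Rightarrow> real) \<times> (nat \<Rightarrow> real) \<times> (nat \<Rightarrow> real \<Rightarrow> real)) set" where
  "mixed_regression_class a b K \<sigma> x0 = {(p, f, l, m).
     p \<in> prob_densities {a..b} \<and> f \<in> prob_densities UNIV \<and>
     (\<forall>k\<in>{1..K}. continuous_on {a..b} (m k)) \<and>
     (INF x\<in>{a..b}. p x) > 0 \<and>
     has_bochner_integral lebesgue (\<lambda>y. y * f y) 0 \<and>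
     (\<forall>k\<in>{1..K}. l k > 0) \<and> (\<Sum>k=1..K. l k) = 1 \<and>
     (\<exists>G0. real_distribution G0 \<and> compact (measure_support G0) \<and>
        (\<forall>y. f y = gauss_conv \<sigma> G0 y) \<and>
        (\<forall>j\<in>{1..K}. \<forall>k\<in>{1..K}. j \<noteq> k \<longrightarrow>
           \<bar>m j x0 - m k x0\<bar> > 2 * diameter (measure_support G0))) \<and>
     (\<forall>j\<in>{1..K}. \<forall>k\<in>{1..K}. j \<noteq> k \<longrightarrow> \<bar>l j - l k\<bar> > 0) \<and>
     countable {x\<in>{a..b}. \<exists>j\<in>{1..K}. \<exists>k\<in>{1..K}. j \<noteq> k \<and> m j x = m k x}}"

end

(* Integrating out y gives p = q, and since Gaussian convolution is injective (its Fourier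
   transform never vanishes) the two models have, at every x, the same mixture of translates of
   their mixing measures G and G'. At x0 the translated supports of the measure with the larger diameter D
   are more than D apart, so each component of the other mixture lies inside exactly one of
   them. As there are K components on both sides this is a bijection, and restricting the
   mixture to one component shows that G and G' are translates of each other. Both error
   densities have mean zero, hence f = g and G = G'.
   For a fixed G the weights of a mixture of translates are determined: look at the rightmost
   location where they differ, near the top of the support of G. Off the countable set of
   crossings this matches the regression functions through their distinct weights, so the
   permutation does not depend on x; continuity covers the remaining points. *)
theory Submission
  imports Defs
begin

section \<open>Supports of measures\<close>

lemma null_compl_measure_support:
  fixes G :: "'a::second_countable_topology measure"
  assumes "sets G = sets borel"
  shows "- measure_support G \<in> null_sets G"
proof -
  define \<F> where "\<F> = {U. open U \<and> emeasure G U = 0}"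
  \<comment> \<open>By second countability, the union of all open null sets equals a countable
    subunion and is therefore null itself.\<close>
  obtain \<F>' where \<F>': "\<F>' \<subseteq> \<F>" "countable \<F>'" "\<Union>\<F>' = \<Union>\<F>"
    by (rule Lindelof[of \<F>]) (auto simp: \<F>_def)
  have "- measure_support G = \<Union>\<F>"
    by (auto simp: measure_support_def \<F>_def zero_less_iff_neq_zero)
  moreover have "(\<Union>U\<in>\<F>'. U) \<in> null_sets G"
    using \<F>' by (intro null_sets_UN') (auto simp: \<F>_def null_sets_def assms)
  ultimately show ?thesis
    using \<F>'(3) by simp
qed

lemma closed_measure_support: "closed (measure_support G)"
proof -
  have "- measure_support G = \<Union>{U. open U \<and> emeasure G U = 0}"
    by (auto simp: measure_support_def zero_less_iff_neq_zero)
  then show ?thesis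
    by (simp add: closed_def open_Union)
qed

lemma (in real_distribution) measure_Int_superset_support:
  assumes "measure_support M \<subseteq> A" "A \<in> sets borel" "B \<in> sets borel"
  shows "measure M (B \<inter> A) = measure M B"
proof (rule measure_eq_AE)
  show "AE x in M. x \<in> B \<inter> A \<longleftrightarrow> x \<in> B"
    using null_compl_measure_support[OF events_eq_borel] by (rule AE_I') (use assms in auto)
qed (use assms in auto)

lemma (in real_distribution) measure_superset_support:
  assumes "measure_support M \<subseteq> A" "A \<in> sets borel"
  shows "measure M A = 1"
  using measure_Int_superset_support[OF assms, of UNIV] prob_space by simp

lemma (in real_distribution) measure_disjoint_support:
  assumes "measure_support M \<inter> A = {}" "A \<in> sets borel"
  shows "measure M A = 0"
  using measure_Int_superset_support[of "- A" A] assms by auto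

lemma (in real_distribution) measure_support_subset:
  assumes "closed A" "measure M A = 1"
  shows "measure_support M \<subseteq> A"
proof
  fix x assume "x \<in> measure_support M"
  moreover have "measure M (- A) = 0"
    using prob_compl[of A] assms by (simp add: Compl_eq_Diff_UNIV)
  moreover have "open (- A)"
    using assms(1) by (simp add: open_Compl)
  ultimately show "x \<in> A"
    unfolding measure_support_def by (force simp: emeasure_eq_measure)
qed

lemma (in real_distribution) measure_support_nonempty: "measure_support M \<noteq> {}"
  using measure_disjoint_support[of UNIV] prob_space by auto

section \<open>Finite mixtures of translates of one measure\<close>

lemma shift_vimage_borel [simp]:
  fixes c :: real
  assumes "B \<in> sets borel"
  shows "(+) c -` B \<in> sets borel"
  using assms by (intro measurable_sets_borel[of _ borel]) simp_all

text \<open>This is the law of \<open>m i + \<theta>\<close> for a random label \<open>i\<close>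
  with weights \<open>l\<close> and an independent error \<open>\<theta>\<close> with law
  \<open>G\<close>. As an image of a product measure, it lets Fubini turn integrals into weighted
  sums over the labels.\<close>

definition location_mixture ::
  "'i set \<Rightarrow> ('i \<Rightarrow> real) \<Rightarrow> ('i \<Rightarrow> real) \<Rightarrow> real measure \<Rightarrow> real measure" where
  "location_mixture I l m G =
     distr (point_measure I (\<lambda>i. ennreal (l i)) \<Otimes>\<^sub>M G) borel (\<lambda>(i, \<theta>). m i + \<theta>)"

context
  fixes I :: "'i set" and l m :: "'i \<Rightarrow> real" and G :: "real measure"
  assumes G: "real_distribution G"
    and fin: "finite I" and l_nonneg: "\<And>i. i \<in> I \<Longrightarrow> 0 \<le> l i" and l_sum: "sum l I = 1"
begin

interpretation G: real_distribution G
  by (fact G)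

interpretation weights: prob_space "point_measure I (\<lambda>i. ennreal (l i))"
proof
  show "emeasure (point_measure I (\<lambda>i. ennreal (l i))) (space (point_measure I (\<lambda>i. ennreal (l i)))) = 1"
    using fin l_nonneg l_sum by (simp add: space_point_measure emeasure_point_measure_finite sum_ennreal)
qed

interpretation pair: pair_prob_space "point_measure I (\<lambda>i. ennreal (l i))" G
  by standard

lemma measurable_location_shift:
  "(\<lambda>(i, \<theta>). m i + \<theta>) \<in> borel_measurable (point_measure I (\<lambda>i. ennreal (l i)) \<Otimes>\<^sub>M G)"
proof -
  \<comment> \<open>Every subset of \<open>I\<close> is measurable for the point measure, so no
    condition on \<open>m\<close> arises.\<close>
  have "m \<in> borel_measurable (point_measure I (\<lambda>i. ennreal (l i)))"
    by (simp add: measurable_def space_point_measure sets_point_measure)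
  then show ?thesis
    by measurable
qed

lemma real_distribution_location_mixture: "real_distribution (location_mixture I l m G)"
  unfolding location_mixture_def
  by (intro pair.P.real_distribution_distr measurable_location_shift)

lemma integral_location_mixture:
  fixes h :: "real \<Rightarrow> real"
  assumes [measurable]: "h \<in> borel_measurable borel" and bound: "\<And>x. \<bar>h x\<bar> \<le> B"
  shows "integral\<^sup>L (location_mixture I l m G) h = (\<Sum>i\<in>I. l i * (LINT \<theta>|G. h (m i + \<theta>)))"
proof -
  let ?P = "point_measure I (\<lambda>i. ennreal (l i))"
  note [measurable] = measurable_location_shift
  have "integral\<^sup>L (location_mixture I l m G) h = (LINT z|(?P \<Otimes>\<^sub>M G). h ((\<lambda>(i, \<theta>). m i + \<theta>) z))"
    unfolding location_mixture_def by (intro integral_distr) measurable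
  also have "\<dots> = (LINT i|?P. LINT \<theta>|G. h (m i + \<theta>))"
  proof -
    have "integrable (?P \<Otimes>\<^sub>M G) (\<lambda>z. h ((\<lambda>(i, \<theta>). m i + \<theta>) z))"
      by (rule pair.P.integrable_const_bound[where B = B]) (auto simp: bound)
    from pair.integral_fst'[OF this] show ?thesis by simp
  qed
  also have "\<dots> = (\<Sum>i\<in>I. l i * (LINT \<theta>|G. h (m i + \<theta>)))"
    using fin l_nonneg by (simp add: lebesgue_integral_point_measure_finite)
  finally show ?thesis .
qed

lemma measure_location_mixture:
  assumes [measurable]: "B \<in> sets borel"
  shows "measure (location_mixture I l m G) B = (\<Sum>i\<in>I. l i * measure G ((+) (m i) -` B))"
proof -
  interpret L: real_distribution "location_mixture I l m G"
    by (rule real_distribution_location_mixture)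
  have "measure (location_mixture I l m G) B = integral\<^sup>L (location_mixture I l m G) (indicator B)"
    by simp
  also have "\<dots> = (\<Sum>i\<in>I. l i * (LINT \<theta>|G. indicator B (m i + \<theta>)))"
    by (rule integral_location_mixture[where B = 1]) (auto simp: indicator_def)
  also have "\<dots> = (\<Sum>i\<in>I. l i * measure G ((+) (m i) -` B))"
  proof (intro sum.cong refl arg_cong2[where f = "(*)"])
    fix i
    have "(LINT \<theta>|G. indicator B (m i + \<theta>)) = (LINT \<theta>|G. indicator ((+) (m i) -` B) \<theta> :: real)"
      by (simp add: indicator_vimage[symmetric] indicator_def)
    then show "(LINT \<theta>|G. indicator B (m i + \<theta>)) = measure G ((+) (m i) -` B)"
      by simp
  qed
  finally show ?thesis .
qed

lemma gauss_conv_location_mixture: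
  assumes "0 < \<sigma>"
  shows "gauss_conv \<sigma> (location_mixture I l m G) y = (\<Sum>i\<in>I. l i * gauss_conv \<sigma> G (y - m i))"
proof -
  have "\<bar>normal_density 0 \<sigma> (y - x)\<bar> \<le> 1 / sqrt (2 * pi * \<sigma>\<^sup>2)" for x
    using assms by (simp add: normal_density_def divide_right_mono)
  from integral_location_mixture[OF _ this] show ?thesis
    by (simp add: gauss_conv_def algebra_simps)
qed

end

section \<open>Gaussian convolution and its injectivity\<close>

lemma measurable_gauss_conv [measurable]:
  assumes "real_distribution G"
  shows "gauss_conv \<sigma> G \<in> borel_measurable borel"
proof -
  interpret real_distribution G by fact
  show ?thesis
    unfolding gauss_conv_def by measurable
qed

lemma gauss_conv_shift:
  assumes "real_distribution G"
  shows "gauss_conv \<sigma> (distr G borel ((+) c)) y = gauss_conv \<sigma> G (y - c)"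
proof -
  interpret real_distribution G by fact
  show ?thesis
    unfolding gauss_conv_def by (subst integral_distr) (auto simp: algebra_simps)
qed

text \<open>Substituting \<open>y = \<sigma> * u\<close> reduces the integral to the characteristic
  function of the standard normal law at \<open>t * \<sigma>\<close>.\<close>

lemma fourier_normal_density:
  assumes "0 < \<sigma>"
  shows "(CLINT y|lborel. iexp (t * y) * normal_density 0 \<sigma> y) = exp (- (t * \<sigma>)\<^sup>2 / 2)"
proof -
  have scale: "normal_density 0 \<sigma> (u * \<sigma>) = std_normal_density u / \<sigma>" for u
    using assms by (simp add: normal_density_def real_sqrt_mult power_mult_distrib field_simps)
  have "(CLINT y|lborel. iexp (t * y) * normal_density 0 \<sigma> y) =
      \<bar>\<sigma>\<bar> *\<^sub>R (CLINT u|lborel. iexp (t * (0 + \<sigma> * u)) * normal_density 0 \<sigma> (0 + \<sigma> * u))"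
    using assms by (intro lborel_integral_real_affine) auto
  also have "\<dots> = (CLINT u|lborel. \<bar>\<sigma>\<bar> *\<^sub>R (iexp (t * (0 + \<sigma> * u)) * normal_density 0 \<sigma> (0 + \<sigma> * u)))"
    using assms by (subst integral_scaleR_right) auto
  also have "\<dots> = (CLINT u|lborel. std_normal_density u *\<^sub>R iexp ((t * \<sigma>) * u))"
    using assms by (intro Bochner_Integration.integral_cong)
      (auto simp: scale scaleR_conv_of_real mult_ac)
  also have "\<dots> = char std_normal_distribution (t * \<sigma>)"
    unfolding char_def by (subst integral_density) auto
  finally show ?thesis
    by (simp add: char_std_normal_distribution)
qed

text \<open>The convolution theorem, by Fubini: the modulus of \<open>?F \<theta> y\<close> is the
  normal density in \<open>y\<close> with mean \<open>\<theta>\<close>, which integrates to 1 for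
  every \<open>\<theta>\<close>, and \<open>G\<close> is a probability measure.\<close>

lemma fourier_gauss_conv:
  assumes "real_distribution G" "0 < \<sigma>"
  shows "(CLINT y|lborel. iexp (t * y) * gauss_conv \<sigma> G y) = char G t * exp (- (t * \<sigma>)\<^sup>2 / 2)"
proof -
  interpret real_distribution G by fact
  interpret pair_sigma_finite G lborel ..
  let ?F = "\<lambda>\<theta> y. iexp (t * y) * complex_of_real (normal_density 0 \<sigma> (y - \<theta>))"
  have shift: "normal_density 0 \<sigma> (y - \<theta>) = normal_density \<theta> \<sigma> y" for y \<theta>
    by (simp add: normal_density_def)
  have norm: "norm (?F \<theta> y) = normal_density \<theta> \<sigma> y" for \<theta> y
    using assms by (simp add: norm_mult shift)
  have int: "integrable (G \<Otimes>\<^sub>M lborel) (\<lambda>(\<theta>, y). ?F \<theta> y)"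
  proof (rule Fubini_integrable)
    show "(\<lambda>(\<theta>, y). ?F \<theta> y) \<in> borel_measurable (G \<Otimes>\<^sub>M lborel)"
      by measurable
    show "integrable G (\<lambda>\<theta>. LINT y|lborel. norm (case (\<theta>, y) of (\<theta>, y) \<Rightarrow> ?F \<theta> y))"
      using assms by (simp only: prod.case norm) (simp add: integral_normal_density)
    show "AE \<theta> in G. integrable lborel (\<lambda>y. case (\<theta>, y) of (\<theta>, y) \<Rightarrow> ?F \<theta> y)"
    proof (intro AE_I2)
      fix \<theta>
      have "integrable lborel (normal_density \<theta> \<sigma>)"
        using assms by (simp add: integrable_normal_density)
      then show "integrable lborel (\<lambda>y. case (\<theta>, y) of (\<theta>, y) \<Rightarrow> ?F \<theta> y)"
        by (rule Bochner_Integration.integrable_bound) (auto simp only: prod.case norm, auto)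
    qed
  qed
  have inner: "(CLINT y|lborel. ?F \<theta> y) = iexp (t * \<theta>) * exp (- (t * \<sigma>)\<^sup>2 / 2)" for \<theta>
  proof -
    have "(CLINT y|lborel. ?F \<theta> y) = \<bar>1\<bar> *\<^sub>R (CLINT u|lborel. ?F \<theta> (\<theta> + 1 * u))"
      by (rule lborel_integral_real_affine) simp
    also have "\<dots> = (CLINT u|lborel. iexp (t * \<theta>) * (iexp (t * u) * normal_density 0 \<sigma> u))"
      by (simp add: algebra_simps exp_add)
    finally show ?thesis
      using fourier_normal_density[OF assms(2), of t] by simp
  qed
  have "(CLINT y|lborel. iexp (t * y) * gauss_conv \<sigma> G y) = (CLINT y|lborel. CLINT \<theta>|G. ?F \<theta> y)"
    by (simp add: gauss_conv_def)
  also have "\<dots> = (CLINT \<theta>|G. CLINT y|lborel. ?F \<theta> y)"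
    by (rule Fubini_integral[OF int])
  also have "\<dots> = char G t * exp (- (t * \<sigma>)\<^sup>2 / 2)"
    by (simp only: inner char_def integral_mult_left_zero)
  finally show ?thesis .
qed

text \<open>The factor \<open>exp (- (t * \<sigma>)\<^sup>2 / 2)\<close> is never zero, so it
  cancels and leaves equal characteristic functions.\<close>

lemma gauss_conv_inject:
  assumes "real_distribution G" "real_distribution G'" "0 < \<sigma>"
    and "gauss_conv \<sigma> G = gauss_conv \<sigma> G'"
  shows "G = G'"
proof (rule Levy_uniqueness)
  show "char G = char G'"
  proof
    fix t
    show "char G t = char G' t"
      using fourier_gauss_conv[OF assms(1,3), of t] fourier_gauss_conv[OF assms(2,3), of t] assms(4)
      by simp
  qed
qed fact+

section \<open>Recovering the mixing measure up to translation\<close>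

lemma support_location_mixture_cover:
  assumes "real_distribution G" "real_distribution G'" "finite I"
    and "\<And>i. i \<in> I \<Longrightarrow> 0 < l i" "sum l I = 1" "\<And>i. i \<in> I \<Longrightarrow> 0 < \<pi> i" "sum \<pi> I = 1"
    and eq: "location_mixture I l m G = location_mixture I \<pi> \<mu> G'"
    and k: "k \<in> I" and s: "s \<in> measure_support G'"
  shows "\<exists>j\<in>I. \<mu> k + s - m j \<in> measure_support G"
proof -
  interpret G: real_distribution G by fact
  interpret G': real_distribution G' by fact
  \<comment> \<open>\<open>U\<close> is closed and carries each component of the first mixture,
    hence also the whole second mixture. The weights \<open>\<pi>\<close> being positive, every
    component of the second mixture must give \<open>U\<close> full mass, so its support lies in
    \<open>U\<close>.\<close>
  define U where "U = (\<Union>j\<in>I. (\<lambda>y. y - m j) -` measure_support G)"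
  have closed_U: "closed U"
    unfolding U_def
    by (intro closed_UN ballI closed_vimage assms closed_measure_support continuous_intros)
  have [measurable]: "U \<in> sets borel"
    using closed_U by simp
  have "measure G ((+) (m i) -` U) = 1" if "i \<in> I" for i
    using that by (intro G.measure_superset_support shift_vimage_borel \<open>U \<in> sets borel\<close>)
      (auto simp: U_def intro!: bexI[of _ i])
  then have "measure (location_mixture I l m G) U = 1"
    using assms by (subst measure_location_mixture) (auto simp: less_imp_le)
  then have "(\<Sum>i\<in>I. \<pi> i * measure G' ((+) (\<mu> i) -` U)) = 1"
    unfolding eq using assms by (subst (asm) measure_location_mixture) (auto simp: less_imp_le)
  then have "(\<Sum>i\<in>I. \<pi> i * (1 - measure G' ((+) (\<mu> i) -` U))) = 0"
    using assms(7) by (simp add: algebra_simps sum_subtractf)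
  then have "\<pi> k * (1 - measure G' ((+) (\<mu> k) -` U)) = 0"
    using assms k by (subst (asm) sum_nonneg_eq_0_iff) (auto simp: less_imp_le)
  then have "measure G' ((+) (\<mu> k) -` U) = 1"
    using assms k by fastforce
  moreover have "closed ((+) (\<mu> k) -` U)"
    by (intro closed_vimage closed_U continuous_intros)
  ultimately show ?thesis
    using G'.measure_support_subset s by (auto simp: U_def)
qed

text \<open>The separation is measured by the larger of the two diameters. The gaps between the
  translated supports of \<open>G\<close> are then too wide for a translated support of
  \<open>G'\<close> to meet two of them.\<close>

lemma location_mixture_matching_components:
  assumes "real_distribution G" "real_distribution G'" "finite I"
    and l: "\<And>i. i \<in> I \<Longrightarrow> 0 < l i" "sum l I = 1"
    and \<pi>: "\<And>i. i \<in> I \<Longrightarrow> 0 < \<pi> i" "sum \<pi> I = 1"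
    and eq: "location_mixture I l m G = location_mixture I \<pi> \<mu> G'"
    and bounded: "bounded (measure_support G)" "bounded (measure_support G')"
    and diam: "diameter (measure_support G') \<le> diameter (measure_support G)"
    and sep: "\<And>i j. i \<in> I \<Longrightarrow> j \<in> I \<Longrightarrow> i \<noteq> j \<Longrightarrow> 2 * diameter (measure_support G) < \<bar>m i - m j\<bar>"
  obtains j k where "j \<in> I" "k \<in> I" "distr G borel ((+) (m j)) = distr G' borel ((+) (\<mu> k))"
proof -
  interpret G: real_distribution G by fact
  interpret G': real_distribution G' by fact
  define D where "D = diameter (measure_support G)"
  define C where "C i = (\<lambda>y. y - m i) -` measure_support G" for i
  define C' where "C' i = (\<lambda>y. y - \<mu> i) -` measure_support G'" for i
  have sets_C [measurable]: "C i \<in> sets borel" for i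
    unfolding C_def by (intro borel_closed closed_vimage closed_measure_support continuous_intros)
  have diam_G: "\<bar>s - t\<bar> \<le> D" if "s \<in> measure_support G" "t \<in> measure_support G" for s t
    using diameter_bounded_bound[OF bounded(1) that] by (simp add: D_def dist_real_def)
  have diam_G': "\<bar>s - t\<bar> \<le> D" if "s \<in> measure_support G'" "t \<in> measure_support G'" for s t
    using diameter_bounded_bound[OF bounded(2) that] diam by (simp add: D_def dist_real_def)
  \<comment> \<open>With \<open>x - m i\<close> and \<open>y - m j\<close> at most \<open>D\<close>
    apart and the centres more than \<open>2 * D\<close> apart, points of different sets
    \<open>C\<close> are more than \<open>D\<close> apart. Taking \<open>x = y\<close> shows that
    the sets are disjoint.\<close>
  have sep_C: "i = j" if "i \<in> I" "j \<in> I" "x \<in> C i" "y \<in> C j" "\<bar>x - y\<bar> \<le> D" for i j x y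
  proof (rule ccontr)
    assume "i \<noteq> j"
    then have "2 * D < \<bar>m i - m j\<bar>"
      using sep that by (simp add: D_def)
    moreover have "\<bar>(x - m i) - (y - m j)\<bar> \<le> D"
      using that by (intro diam_G) (auto simp: C_def)
    ultimately show False
      using that(5) by linarith
  qed
  have D_nonneg: "0 \<le> D"
    using bounded(1) by (simp add: D_def diameter_ge_0)
  \<comment> \<open>One point of \<open>C' k\<close> selects \<open>j\<close>; every other point of
    \<open>C' k\<close> is within \<open>D\<close> of it and lies in some \<open>C i\<close>, which
    forces \<open>i = j\<close>.\<close>
  have "\<exists>j\<in>I. C' k \<subseteq> C j" if "k \<in> I" for k
  proof -
    have cover: "\<exists>j\<in>I. y \<in> C j" if "y \<in> C' k" for y
      using support_location_mixture_cover[OF assms(1-8) \<open>k \<in> I\<close>, of "y - \<mu> k"] that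
      by (simp add: C_def C'_def)
    obtain s where "s \<in> measure_support G'"
      using G'.measure_support_nonempty by auto
    then have s: "\<mu> k + s \<in> C' k"
      by (simp add: C'_def)
    then obtain j where j: "j \<in> I" "\<mu> k + s \<in> C j"
      using cover by blast
    have "y \<in> C j" if y: "y \<in> C' k" for y
    proof -
      obtain i where i: "i \<in> I" "y \<in> C i"
        using cover y by blast
      have "\<bar>(y - \<mu> k) - (\<mu> k + s - \<mu> k)\<bar> \<le> D"
        using y s by (intro diam_G') (auto simp: C'_def)
      then have "i = j"
        using i j by (intro sep_C[of i j y "\<mu> k + s"]) auto
      with i show ?thesis by simp
    qed
    with j show ?thesis by blast
  qed
  then obtain \<phi> where \<phi>: "\<And>k. k \<in> I \<Longrightarrow> \<phi> k \<in> I" "\<And>k. k \<in> I \<Longrightarrow> C' k \<subseteq> C (\<phi> k)"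
    by metis
  \<comment> \<open>The covering lemma with the roles exchanged puts a point of \<open>C j\<close>
    into some \<open>C' k\<close>, which lies in \<open>C (\<phi> k)\<close>; disjointness gives
    \<open>j = \<phi> k\<close>. A surjection of a finite set onto itself is injective, so a single
    component of the second mixture sits in each \<open>C j\<close>.\<close>
  have "I \<subseteq> \<phi> ` I"
  proof
    fix j assume j: "j \<in> I"
    obtain s where s: "s \<in> measure_support G"
      using G.measure_support_nonempty by auto
    obtain k where k: "k \<in> I" "m j + s \<in> C' k"
      using support_location_mixture_cover[OF assms(2,1,3) \<pi> l eq[symmetric] j s]
      by (auto simp: C'_def)
    have "j = \<phi> k"
      using j k s \<phi> D_nonneg by (intro sep_C[of _ _ "m j + s" "m j + s"]) (auto simp: C_def)
    with k show "j \<in> \<phi> ` I" by blast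
  qed
  with \<phi>(1) have "\<phi> ` I = I"
    by blast
  then have inj: "inj_on \<phi> I"
    using \<open>finite I\<close> by (intro eq_card_imp_inj_on) auto
  obtain k where k: "k \<in> I"
    using l(2) by fastforce
  define j where "j = \<phi> k"
  have j: "j \<in> I"
    using k \<phi> by (simp add: j_def)
  have "measure (location_mixture I l m G) (B \<inter> C j) = l j * measure G ((+) (m j) -` B)"
    if [measurable]: "B \<in> sets borel" for B
  proof -
    have "measure G ((+) (m i) -` (B \<inter> C j)) = 0" if "i \<in> I - {j}" for i
    proof (rule G.measure_disjoint_support)
      show "measure_support G \<inter> (+) (m i) -` (B \<inter> C j) = {}"
      proof (rule ccontr)
        assume "measure_support G \<inter> (+) (m i) -` (B \<inter> C j) \<noteq> {}"
        then obtain s where "s \<in> measure_support G" "m i + s \<in> C j"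
          by auto
        then have "i = j"
          using \<open>i \<in> I - {j}\<close> j D_nonneg
          by (intro sep_C[of _ _ "m i + s" "m i + s"]) (auto simp: C_def)
        with \<open>i \<in> I - {j}\<close> show False by simp
      qed
    qed simp
    moreover have "measure G ((+) (m j) -` (B \<inter> C j)) = measure G ((+) (m j) -` B)"
      unfolding vimage_Int by (intro G.measure_Int_superset_support shift_vimage_borel sets_C that)
        (auto simp: C_def)
    ultimately show ?thesis
      using \<open>finite I\<close> l j
      by (subst measure_location_mixture) (auto simp: less_imp_le assms(1) sum.remove[of I j])
  qed
  \<comment> \<open>For \<open>i\<close> other than \<open>k\<close>, \<open>C' i\<close> lies in
    \<open>C (\<phi> i)\<close>, which is disjoint from \<open>C j\<close> because
    \<open>\<phi>\<close> is injective.\<close>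
  moreover have "measure (location_mixture I \<pi> \<mu> G') (B \<inter> C j) = \<pi> k * measure G' ((+) (\<mu> k) -` B)"
    if [measurable]: "B \<in> sets borel" for B
  proof -
    have "measure G' ((+) (\<mu> i) -` (B \<inter> C j)) = 0" if i: "i \<in> I - {k}" for i
    proof (rule G'.measure_disjoint_support)
      show "measure_support G' \<inter> (+) (\<mu> i) -` (B \<inter> C j) = {}"
      proof (rule ccontr)
        assume "measure_support G' \<inter> (+) (\<mu> i) -` (B \<inter> C j) \<noteq> {}"
        then obtain s where "s \<in> measure_support G'" "\<mu> i + s \<in> C j"
          by auto
        then have "\<phi> i = j"
          using i j \<phi> D_nonneg
          by (intro sep_C[of _ _ "\<mu> i + s" "\<mu> i + s"]) (auto simp: C'_def subset_iff)
        with i k inj show False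
          by (auto simp: j_def inj_on_def)
      qed
    qed simp
    moreover have "measure G' ((+) (\<mu> k) -` (B \<inter> C j)) = measure G' ((+) (\<mu> k) -` B)"
      unfolding vimage_Int
      using \<phi>(2)[OF k] by (intro G'.measure_Int_superset_support shift_vimage_borel sets_C that)
        (auto simp: C'_def j_def subset_iff)
    ultimately show ?thesis
      using \<open>finite I\<close> \<pi> k
      by (subst measure_location_mixture) (auto simp: less_imp_le assms(2) sum.remove[of I k])
  qed
  ultimately have scaled:
    "l j * measure G ((+) (m j) -` B) = \<pi> k * measure G' ((+) (\<mu> k) -` B)"
    if "B \<in> sets borel" for B
    using eq that by metis
  \<comment> \<open>Comparing total masses shows that the two weights agree, after which they cancel
    for every \<open>B\<close>.\<close>
  from this[of UNIV] have "l j = \<pi> k"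
    using G.prob_space G'.prob_space by simp
  with scaled l(1)[OF j] have "measure G ((+) (m j) -` B) = measure G' ((+) (\<mu> k) -` B)"
    if "B \<in> sets borel" for B
    using that by auto
  then have "distr G borel ((+) (m j)) = distr G' borel ((+) (\<mu> k))"
    by (intro measure_eqI)
      (auto simp: emeasure_distr G.emeasure_eq_measure G'.emeasure_eq_measure)
  with j k show thesis
    by (rule that)
qed

section \<open>Uniqueness of the weights for a fixed mixing measure\<close>

lemma location_mixture_weights_unique:
  assumes G: "real_distribution G" and fin: "finite I"
    and l: "\<And>i. i \<in> I \<Longrightarrow> 0 \<le> l i" "sum l I = 1"
    and \<pi>: "\<And>i. i \<in> I \<Longrightarrow> 0 \<le> \<pi> i" "sum \<pi> I = 1"
    and eq: "location_mixture I l m G = location_mixture I \<pi> \<mu> G"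
    and compact: "compact (measure_support G)"
  shows "sum l {i\<in>I. m i = z} = sum \<pi> {i\<in>I. \<mu> i = z}"
proof (rule ccontr)
  assume neq: "sum l {i\<in>I. m i = z} \<noteq> sum \<pi> {i\<in>I. \<mu> i = z}"
  interpret G: real_distribution G by fact
  \<comment> \<open>Locations may coincide, so only the total weight at each point can be
    determined. \<open>c\<close> is the discrepancy there, and \<open>t\<close> below is the
    rightmost location where it does not vanish.\<close>
  define c where "c z = sum l {i\<in>I. m i = z} - sum \<pi> {i\<in>I. \<mu> i = z}" for z
  define Z where "Z = {z \<in> m ` I \<union> \<mu> ` I. c z \<noteq> 0}"
  have fin_Z: "finite Z"
    using fin by (simp add: Z_def)
  have "z \<in> m ` I \<union> \<mu> ` I"
  proof (rule ccontr)
    assume "z \<notin> m ` I \<union> \<mu> ` I"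
    then have "{i\<in>I. m i = z} = {}" "{i\<in>I. \<mu> i = z} = {}"
      by auto
    with neq show False
      by (simp only: sum.empty)
  qed
  with neq have "Z \<noteq> {}"
    by (auto simp: Z_def c_def)
  define t where "t = Max Z"
  have t: "t \<in> Z" "\<And>u. u \<in> Z \<Longrightarrow> u \<le> t"
    using fin_Z \<open>Z \<noteq> {}\<close> by (auto simp: t_def)
  obtain s where s: "s \<in> measure_support G" "\<And>r. r \<in> measure_support G \<Longrightarrow> r \<le> s"
    using compact_attains_sup[OF compact G.measure_support_nonempty] by blast
  \<comment> \<open>\<open>w\<close> lies strictly left of \<open>t\<close> and bounds every other
    location in \<open>Z\<close>; inserting \<open>t - 1\<close> supplies a value when there is
    none. As \<open>s\<close> is the top of the support, the half-line beyond \<open>w + s\<close>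
    misses all those other translates but is an open neighbourhood of \<open>t + s\<close>.\<close>
  define w where "w = Max (insert (t - 1) (Z - {t}))"
  have "w \<in> insert (t - 1) (Z - {t})"
    unfolding w_def using fin_Z by (intro Max_in) auto
  then have w: "w < t" "\<And>u. u \<in> Z - {t} \<Longrightarrow> u \<le> w"
    using fin_Z t by (auto simp: w_def less_le)
  define h where "h u = measure G ((+) u -` {w + s<..})" for u
  have h_eq_0: "h u = 0" if "u \<in> Z - {t}" for u
    unfolding h_def
  proof (rule G.measure_disjoint_support)
    have "u + r \<le> w + s" if "r \<in> measure_support G" for r
      using w(2)[OF \<open>u \<in> Z - {t}\<close>] s(2)[OF that] by simp
    then show "measure_support G \<inter> (+) u -` {w + s<..} = {}"
      by fastforce
  qed simp
  have "emeasure G ((+) t -` {w + s<..}) > 0"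
  proof -
    have "open ((+) t -` {w + s<..})"
      by (intro open_vimage continuous_intros)
    then show ?thesis
      using s(1) w(1) by (auto simp: measure_support_def)
  qed
  then have h_t: "h t > 0"
    by (simp add: h_def G.emeasure_eq_measure)
  \<comment> \<open>Indices are collected by location, so that equality of the two mixtures on the
    half-line becomes one equation in \<open>c\<close>; only its term at \<open>t\<close>
    survives.\<close>
  have group: "(\<Sum>u\<in>m ` I \<union> \<mu> ` I. sum \<alpha> {i\<in>I. \<beta> i = u} * h u) = (\<Sum>i\<in>I. \<alpha> i * h (\<beta> i))"
    if "\<beta> ` I \<subseteq> m ` I \<union> \<mu> ` I" for \<alpha> \<beta>
  proof -
    have "(\<Sum>u\<in>m ` I \<union> \<mu> ` I. sum \<alpha> {i\<in>I. \<beta> i = u} * h u) =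
        (\<Sum>u\<in>m ` I \<union> \<mu> ` I. \<Sum>i\<in>{i\<in>I. \<beta> i = u}. \<alpha> i * h (\<beta> i))"
      by (auto simp: sum_distrib_right intro!: sum.cong)
    also have "\<dots> = (\<Sum>i\<in>I. \<alpha> i * h (\<beta> i))"
      using fin that by (intro sum.group) auto
    finally show ?thesis .
  qed
  have "(\<Sum>i\<in>I. l i * h (m i)) = (\<Sum>i\<in>I. \<pi> i * h (\<mu> i))"
    using measure_location_mixture[OF G fin l, of "{w + s<..}" m]
      measure_location_mixture[OF G fin \<pi>, of "{w + s<..}" \<mu>] eq
    by (simp add: h_def)
  then have "0 = (\<Sum>u\<in>m ` I \<union> \<mu> ` I. c u * h u)"
    unfolding c_def left_diff_distrib sum_subtractf by (simp add: group)
  also have "\<dots> = (\<Sum>u\<in>Z. c u * h u)"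
    using fin by (intro sum.mono_neutral_right) (auto simp: Z_def)
  also have "\<dots> = c t * h t"
    using fin_Z t h_eq_0 by (subst sum.remove[of Z t]) auto
  finally show False
    using t(1) h_t by (auto simp: Z_def)
qed

section \<open>Centering, density arguments and integrals\<close>

lemma has_bochner_integral_shift:
  fixes f :: "real \<Rightarrow> real"
  assumes "has_bochner_integral lborel f I"
  shows "has_bochner_integral lborel (\<lambda>y. f (y - c)) I"
  using assms lborel_has_bochner_integral_real_affine_iff[of 1 f I "- c"] by simp

lemma mean_shift:
  fixes f :: "real \<Rightarrow> real"
  assumes "has_bochner_integral lborel f 1" "has_bochner_integral lborel (\<lambda>y. y * f y) 0"
  shows "has_bochner_integral lborel (\<lambda>y. y * f (y - c)) c"
proof -
  have "has_bochner_integral lborel (\<lambda>y. (y - c) * f (y - c) + c * f (y - c)) (0 + c * 1)"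
    using assms by (intro has_bochner_integral_add has_bochner_integral_mult_right
        has_bochner_integral_shift[where f = "\<lambda>y. y * f y"] has_bochner_integral_shift[where f = f])
  then show ?thesis
    by (simp add: algebra_simps)
qed

text \<open>The common translate has first moment \<open>c\<close> when computed from
  \<open>f\<close> and \<open>d\<close> when computed from \<open>g\<close>, so the two shifts are
  equal.\<close>

lemma centered_density_shift_unique:
  fixes f g :: "real \<Rightarrow> real"
  assumes "has_bochner_integral lborel f 1" "has_bochner_integral lborel (\<lambda>y. y * f y) 0"
    and "has_bochner_integral lborel g 1" "has_bochner_integral lborel (\<lambda>y. y * g y) 0"
    and eq: "\<And>y. f (y - c) = g (y - d)"
  shows "f = g"
proof -
  have "c = d"
    using mean_shift[OF assms(1,2), of c] mean_shift[OF assms(3,4), of d] eq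
    by (simp add: has_bochner_integral_eq)
  show ?thesis
  proof
    fix y
    show "f y = g y"
      using eq[of "y + c"] \<open>c = d\<close> by simp
  qed
qed

text \<open>Every nonempty open interval is uncountable, so removing \<open>N\<close> leaves a dense
  subset of the interval, and a continuous difference vanishing there vanishes throughout.\<close>

lemma continuous_eq_off_countable:
  fixes f g :: "real \<Rightarrow> real"
  assumes "a < b" "continuous_on {a..b} f" "continuous_on {a..b} g" "countable N"
    and eq: "\<And>x. x \<in> {a..b} - N \<Longrightarrow> f x = g x" and x: "x \<in> {a..b}"
  shows "f x = g x"
proof -
  have "{a<..<b} \<subseteq> closure ({a<..<b} - N)"
  proof
    fix z assume z: "z \<in> {a<..<b}"
    show "z \<in> closure ({a<..<b} - N)"
      unfolding closure_approachable
    proof (intro allI impI)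
      fix e :: real assume "e > 0"
      then have "z < min b (z + e)"
        using z by simp
      then have "uncountable {z<..<min b (z + e)}"
        by (simp add: uncountable_open_interval)
      then have "\<not> {z<..<min b (z + e)} \<subseteq> N"
        using assms(4) countable_subset by blast
      then obtain y where "y \<in> {z<..<min b (z + e)}" "y \<notin> N"
        by blast
      then show "\<exists>y\<in>{a<..<b} - N. dist y z < e"
        using z by (intro bexI[of _ y]) (auto simp: dist_real_def)
    qed
  qed
  then have "closure {a<..<b} \<subseteq> closure ({a<..<b} - N)"
    by (simp add: closure_minimal)
  moreover have "closure ({a<..<b} - N) \<subseteq> closure {a<..<b}"
    by (intro closure_mono) auto
  ultimately have closure: "closure ({a<..<b} - N) = {a..b}"
    using assms(1) by simp
  have "f x - g x = 0"
  proof (rule continuous_constant_on_closure[where f = "\<lambda>x. f x - g x" and x = x])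
    show "continuous_on (closure ({a<..<b} - N)) (\<lambda>x. f x - g x)"
      unfolding closure by (intro continuous_intros assms)
  qed (use eq x closure in auto)
  then show ?thesis
    by simp
qed

text \<open>A Gaussian convolution is Borel measurable, so its integrals pass from
  \<open>lebesgue\<close> to \<open>lborel\<close>, where the affine substitutions are made.\<close>

lemma gauss_conv_integrals:
  assumes G: "real_distribution G" and f: "\<And>y. f y = gauss_conv \<sigma> G y"
    and "f \<in> prob_densities UNIV" "has_bochner_integral lebesgue (\<lambda>y. y * f y) 0"
  shows "has_bochner_integral lborel f 1" "has_bochner_integral lborel (\<lambda>y. y * f y) 0"
proof -
  have "f = gauss_conv \<sigma> G"
    using f by auto
  then have [measurable]: "f \<in> borel_measurable borel"
    using measurable_gauss_conv[OF G] by simp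
  have "(\<lambda>y. y * f y) \<in> borel_measurable lborel" "f \<in> borel_measurable lborel"
    by measurable
  then show "has_bochner_integral lborel f 1" "has_bochner_integral lborel (\<lambda>y. y * f y) 0"
    using assms(3,4)
    by (auto simp: prob_densities_def set_integrable_def set_lebesgue_integral_def
        has_bochner_integral_iff integrable_completion integral_completion)
qed

text \<open>Nonnegativity bounds the image of \<open>p\<close> below, which makes the
  \<open>INF\<close> a genuine lower bound.\<close>

lemma prob_densities_pos:
  assumes "p \<in> prob_densities A" "0 < (INF x\<in>A. p x)" "x \<in> A"
  shows "0 < p x"
proof -
  have "bdd_below (p ` A)"
    using assms(1) by (auto simp: prob_densities_def intro!: bdd_belowI[of _ 0])
  then have "(INF x\<in>A. p x) \<le> p x"
    using assms(3) by (rule cINF_lower)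
  with assms(2) show ?thesis
    by simp
qed

text \<open>Integrating out \<open>y\<close> isolates the design density: applied to both sides of
  the model equation, this yields \<open>p x = q x\<close>.\<close>

lemma mixture_density_integral:
  fixes f :: "real \<Rightarrow> real"
  assumes "has_bochner_integral lborel f 1" "sum l I = 1"
  shows "has_bochner_integral lborel (\<lambda>y. p * (\<Sum>i\<in>I. l i * f (y - m i))) p"
proof -
  have "has_bochner_integral lborel (\<lambda>y. p * (\<Sum>i\<in>I. l i * f (y - m i))) (p * (\<Sum>i\<in>I. l i * 1))"
    using assms
    by (intro has_bochner_integral_mult_right has_bochner_integral_sum has_bochner_integral_shift)
  then show ?thesis
    using assms(2) by simp
qed

section \<open>Identifiability in the regression class\<close>

lemma mixed_regression_classE:
  fixes K :: nat
  assumes "(p, f, l, m) \<in> mixed_regression_class a b K \<sigma> x0"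
  obtains G where "real_distribution G" "compact (measure_support G)" "\<And>y. f y = gauss_conv \<sigma> G y"
    and "\<And>j k. j \<in> {1..K} \<Longrightarrow> k \<in> {1..K} \<Longrightarrow> j \<noteq> k \<Longrightarrow>
      2 * diameter (measure_support G) < \<bar>m j x0 - m k x0\<bar>"
    and "p \<in> prob_densities {a..b}" "0 < (INF x\<in>{a..b}. p x)"
    and "f \<in> prob_densities UNIV" "has_bochner_integral lebesgue (\<lambda>y. y * f y) 0"
    and "\<And>k. k \<in> {1..K} \<Longrightarrow> 0 < l k" "sum l {1..K} = 1" "inj_on l {1..K}"
    and "\<And>k. k \<in> {1..K} \<Longrightarrow> continuous_on {a..b} (m k)"
    and "countable {x\<in>{a..b}. \<exists>j\<in>{1..K}. \<exists>k\<in>{1..K}. j \<noteq> k \<and> m j x = m k x}"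
proof -
  \<comment> \<open>Distinctness of the weights is recast as injectivity, the form in which a weight
    identifies its index.\<close>
  have inj: "inj_on l {1..K}" if "\<forall>j\<in>{1..K}. \<forall>k\<in>{1..K}. j \<noteq> k \<longrightarrow> \<bar>l j - l k\<bar> > 0"
    using that by (force simp: inj_on_def)
  show thesis
    using assms unfolding mixed_regression_class_def mem_Collect_eq prod.case
    by (elim conjE exE) (rule that; (rule inj)?; blast)
qed

theorem theorem3p1:
  fixes a b \<sigma> x0 :: real and K :: nat
    and p q f g :: "real \<Rightarrow> real" and l \<pi> :: "nat \<Rightarrow> real" and m \<mu> :: "nat \<Rightarrow> real \<Rightarrow> real"
  assumes "a < b" and "K \<ge> 1" and "\<sigma> > 0" and "x0 \<in> {a..b}"
    and "(p, f, l, m) \<in> mixed_regression_class a b K \<sigma> x0"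
    and "(q, g, \<pi>, \<mu>) \<in> mixed_regression_class a b K \<sigma> x0"
    and "\<And>x y. x \<in> {a..b} \<Longrightarrow>
           p x * (\<Sum>k=1..K. l k * f (y - m k x)) = q x * (\<Sum>k=1..K. \<pi> k * g (y - \<mu> k x))"
  shows "(\<forall>x\<in>{a..b}. p x = q x) \<and> f = g \<and>
         (\<exists>\<tau>. \<tau> permutes {1..K} \<and>
            (\<forall>k\<in>{1..K}. \<pi> k = l (\<tau> k) \<and> (\<forall>x\<in>{a..b}. \<mu> k x = m (\<tau> k) x)))"
proof -
  define I where "I = {1..K}"
  have fin: "finite I"
    by (simp add: I_def)
  obtain G where G: "real_distribution G" "compact (measure_support G)"
    and f: "\<And>y. f y = gauss_conv \<sigma> G y"
    and sep: "\<And>j k. j \<in> I \<Longrightarrow> k \<in> I \<Longrightarrow> j \<noteq> k \<Longrightarrow> 2 * diameter (measure_support G) < \<bar>m j x0 - m k x0\<bar>"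
    and p: "p \<in> prob_densities {a..b}" "0 < (INF x\<in>{a..b}. p x)"
    and f_dens: "f \<in> prob_densities UNIV" "has_bochner_integral lebesgue (\<lambda>y. y * f y) 0"
    and l: "\<And>k. k \<in> I \<Longrightarrow> 0 < l k" "sum l I = 1" "inj_on l I"
    and cont_m: "\<And>k. k \<in> I \<Longrightarrow> continuous_on {a..b} (m k)"
    and Z: "countable {x\<in>{a..b}. \<exists>j\<in>I. \<exists>k\<in>I. j \<noteq> k \<and> m j x = m k x}"
    by (rule mixed_regression_classE[OF assms(5), folded I_def]) (rule that; assumption)
  obtain G' where G': "real_distribution G'" "compact (measure_support G')"
    and g: "\<And>y. g y = gauss_conv \<sigma> G' y"
    and sep': "\<And>j k. j \<in> I \<Longrightarrow> k \<in> I \<Longrightarrow> j \<noteq> k \<Longrightarrow> 2 * diameter (measure_support G') < \<bar>\<mu> j x0 - \<mu> k x0\<bar>"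
    and "q \<in> prob_densities {a..b}" "0 < (INF x\<in>{a..b}. q x)"
    and g_dens: "g \<in> prob_densities UNIV" "has_bochner_integral lebesgue (\<lambda>y. y * g y) 0"
    and \<pi>: "\<And>k. k \<in> I \<Longrightarrow> 0 < \<pi> k" "sum \<pi> I = 1" "inj_on \<pi> I"
    and cont_\<mu>: "\<And>k. k \<in> I \<Longrightarrow> continuous_on {a..b} (\<mu> k)"
    and Z': "countable {x\<in>{a..b}. \<exists>j\<in>I. \<exists>k\<in>I. j \<noteq> k \<and> \<mu> j x = \<mu> k x}"
    by (rule mixed_regression_classE[OF assms(6), folded I_def]) (rule that; assumption)
  note f_int = gauss_conv_integrals[OF G(1) f f_dens]
  note g_int = gauss_conv_integrals[OF G'(1) g g_dens]
  have eq: "p x * (\<Sum>k\<in>I. l k * f (y - m k x)) = q x * (\<Sum>k\<in>I. \<pi> k * g (y - \<mu> k x))"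
    if "x \<in> {a..b}" for x y
    using assms(7)[OF that] by (simp add: I_def)
  have p_eq_q: "p x = q x" if x: "x \<in> {a..b}" for x
    using mixture_density_integral[OF f_int(1) l(2), of "p x" "\<lambda>k. m k x"]
      mixture_density_integral[OF g_int(1) \<pi>(2), of "q x" "\<lambda>k. \<mu> k x"]
    unfolding eq[OF x] by (rule has_bochner_integral_eq)
  have mixture_eq: "location_mixture I l (\<lambda>k. m k x) G = location_mixture I \<pi> (\<lambda>k. \<mu> k x) G'"
    if x: "x \<in> {a..b}" for x
  proof (rule gauss_conv_inject[OF _ _ assms(3)])
    show "real_distribution (location_mixture I l (\<lambda>k. m k x) G)"
      "real_distribution (location_mixture I \<pi> (\<lambda>k. \<mu> k x) G')"
      using G G' fin l \<pi> by (auto intro!: real_distribution_location_mixture simp: less_imp_le)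
    show "gauss_conv \<sigma> (location_mixture I l (\<lambda>k. m k x) G) =
        gauss_conv \<sigma> (location_mixture I \<pi> (\<lambda>k. \<mu> k x) G')"
    proof
      fix y
      \<comment> \<open>The common factor \<open>p x = q x\<close> is positive and cancels.\<close>
      have "(\<Sum>k\<in>I. l k * f (y - m k x)) = (\<Sum>k\<in>I. \<pi> k * g (y - \<mu> k x))"
        using eq[OF x, of y] p_eq_q[OF x] prob_densities_pos[OF p x] by simp
      then show "gauss_conv \<sigma> (location_mixture I l (\<lambda>k. m k x) G) y =
          gauss_conv \<sigma> (location_mixture I \<pi> (\<lambda>k. \<mu> k x) G') y"
        using G G' fin l \<pi> assms(3)
        by (simp add: gauss_conv_location_mixture less_imp_le f g)
    qed
  qed
  \<comment> \<open>The matching lemma wants the larger diameter first, so in the second case the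
    two models change places.\<close>
  obtain j k where "distr G borel ((+) (m j x0)) = distr G' borel ((+) (\<mu> k x0))"
  proof (cases "diameter (measure_support G') \<le> diameter (measure_support G)")
    case True
    show ?thesis
      by (rule location_mixture_matching_components[OF G(1) G'(1) fin l(1,2) \<pi>(1,2)
            mixture_eq[OF assms(4)] compact_imp_bounded[OF G(2)] compact_imp_bounded[OF G'(2)] True sep])
        (auto intro: that)
  next
    case False
    then have le: "diameter (measure_support G) \<le> diameter (measure_support G')"
      by simp
    show ?thesis
      by (rule location_mixture_matching_components[OF G'(1) G(1) fin \<pi>(1,2) l(1,2)
            mixture_eq[OF assms(4), symmetric] compact_imp_bounded[OF G'(2)] compact_imp_bounded[OF G(2)] le sep'])
        (auto intro: that[OF sym])
  qed
  then have "f (y - m j x0) = g (y - \<mu> k x0)" for y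
    unfolding f g gauss_conv_shift[OF G(1), symmetric] gauss_conv_shift[OF G'(1), symmetric]
    by simp
  then have f_eq_g: "f = g"
    using f_int g_int by (intro centered_density_shift_unique)
  then have "gauss_conv \<sigma> G = gauss_conv \<sigma> G'"
    using f g by auto
  then have "G = G'"
    using G G' assms(3) by (intro gauss_conv_inject)
  define N where "N = {x\<in>{a..b}. \<exists>j\<in>I. \<exists>k\<in>I. j \<noteq> k \<and> m j x = m k x} \<union>
    {x\<in>{a..b}. \<exists>j\<in>I. \<exists>k\<in>I. j \<noteq> k \<and> \<mu> j x = \<mu> k x}"
  have "countable N"
    using Z Z' by (simp add: N_def)
  \<comment> \<open>Off \<open>N\<close> only \<open>k\<close> sits at \<open>\<mu> k x\<close> in
    the second mixture, so the total weight there is \<open>\<pi> k > 0\<close>. Hence some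
    \<open>j\<close> of the first mixture sits there too, and it is the only one.\<close>
  have match: "\<exists>j\<in>I. \<pi> k = l j \<and> \<mu> k x = m j x" if x: "x \<in> {a..b} - N" and k: "k \<in> I" for x k
  proof -
    have "{i\<in>I. \<mu> i x = \<mu> k x} = {k}"
      using x k by (auto simp: N_def)
    then have weight: "sum l {i\<in>I. m i x = \<mu> k x} = \<pi> k"
      using location_mixture_weights_unique[of G I l \<pi> "\<lambda>i. m i x" "\<lambda>i. \<mu> i x" "\<mu> k x"]
        mixture_eq[of x] G fin l \<pi> x \<open>G = G'\<close> by (simp add: less_imp_le)
    have "{i\<in>I. m i x = \<mu> k x} \<noteq> {}"
    proof
      assume "{i\<in>I. m i x = \<mu> k x} = {}"
      with weight have "\<pi> k = 0"
        by (simp only: sum.empty)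
      with \<pi>(1)[OF k] show False
        by simp
    qed
    then obtain j where j: "j \<in> I" "m j x = \<mu> k x"
      by blast
    moreover have "inj_on (\<lambda>i. m i x) I"
      using x unfolding inj_on_def N_def by blast
    ultimately have "{i\<in>I. m i x = \<mu> k x} = {j}"
      by (auto simp: inj_on_def)
    with weight have "\<pi> k = l j"
      by simp
    with j show ?thesis
      by metis
  qed
  have "0 \<le> diameter (measure_support G)" "0 \<le> diameter (measure_support G')"
    using G G' by (auto intro: diameter_ge_0 compact_imp_bounded)
  then have "m j x0 \<noteq> m k x0" "\<mu> j x0 \<noteq> \<mu> k x0" if "j \<in> I" "k \<in> I" "j \<noteq> k" for j k
    using sep[OF that] sep'[OF that] by auto
  \<comment> \<open>The separation at \<open>x0\<close> exceeds a nonnegative number, so no curves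
    cross there and \<open>x0\<close> can serve to define \<open>\<rho>\<close>.\<close>
  then have "x0 \<in> {a..b} - N"
    using assms(4) unfolding N_def by blast
  from match[OF this] obtain \<rho> where \<rho>: "\<And>k. k \<in> I \<Longrightarrow> \<rho> k \<in> I" "\<And>k. k \<in> I \<Longrightarrow> \<pi> k = l (\<rho> k)"
    by metis
  have "\<mu> k x = m (\<rho> k) x" if k: "k \<in> I" and x: "x \<in> {a..b}" for k x
  proof (rule continuous_eq_off_countable[OF assms(1) _ _ \<open>countable N\<close> _ x])
    fix z assume "z \<in> {a..b} - N"
    then obtain j where j: "j \<in> I" "\<pi> k = l j" "\<mu> k z = m j z"
      using match k by blast
    \<comment> \<open>Both indices carry the weight \<open>\<pi> k\<close>, and the weights
      \<open>l\<close> are distinct; this is why the matching cannot vary with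
      \<open>z\<close>.\<close>
    moreover have "j = \<rho> k"
      using l(3) j k \<rho> by (auto dest: inj_onD)
    ultimately show "\<mu> k z = m (\<rho> k) z"
      by simp
  qed (use k cont_m cont_\<mu> \<rho> in auto)
  moreover have "bij_betw \<rho> I I"
  proof -
    have "inj_on \<rho> I"
      using \<pi>(3) \<rho> by (auto simp: inj_on_def)
    moreover have "\<rho> ` I \<subseteq> I"
      using \<rho> by auto
    ultimately show ?thesis
      using fin by (simp add: bij_betw_def endo_inj_surj)
  qed
  \<comment> \<open>\<open>permutes\<close> demands the identity outside \<open>I\<close>, so
    \<open>\<rho>\<close> is extended that way.\<close>
  ultimately have "(\<lambda>k. if k \<in> I then \<rho> k else k) permutes I \<and>
      (\<forall>k\<in>I. \<pi> k = l (if k \<in> I then \<rho> k else k) \<and>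
        (\<forall>x\<in>{a..b}. \<mu> k x = m (if k \<in> I then \<rho> k else k) x))"
    using \<rho> by (auto intro!: bij_imp_permutes cong: bij_betw_cong)
  then show ?thesis
    unfolding I_def using p_eq_q f_eq_g by blast
qed

end
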